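(* Let $\{u_k\}_{k=0}^{N-1}$ be a sequence with $u_k\in\mathbb{R}^m$. (i) If $\{u_k\}_{k=0}^{N-1}$ is persistently exciting of order $n+1$, then, for any output reachable system $\Sigma\in\bm{\Sigma}_{n,m,p}^{\mathrm{or}}$ and any $x_0\in\mathbb{R}^n$, the output sequence $\{y_k(\Sigma,x_0,u)\}_{k=0}^{N-1}$ is persistently exciting of order $1$. (ii) If $\{u_k\}_{k=0}^{N-1}$ is $K_{\mathrm u}$-persistently exciting of order $n+1$ for some $K_{\mathrm u}\succ0$, then, for any $\Sigma\in\bm{\Sigma}_{n,m,p}^{\mathrm{or}}$ and any $x_0\in\mathbb{R}^n$, $\{y_k(\Sigma,x_0,u)\}_{k=0}^{N-1}$ is $K_{\mathrm y}$-persistently exciting of order $1$ with $$K_{\mathrm y}=\frac{1}{n+1}MK_{\mathrm u}M^\top,$$ where $M$ is the matrix associated with $\Sigma$ as in the context.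
   Context: All matrices are real; $\succ,\succeq$ denote the positive definite / semidefinite ordering of symmetric matrices. System: $\Sigma=(A,B,C,D)$ with $A\in\mathbb{R}^{n\times n}$, $B\in\mathbb{R}^{n\times m}$, $C\in\mathbb{R}^{p\times n}$, $D\in\mathbb{R}^{p\times m}$ denotes the discrete-time linear time-invariant system $x_{k+1}=Ax_k+Bu_k$, $y_k=Cx_k+Du_k$. $\{y_k(\Sigma,x_0,u)\}_{k=0}^{N-1}$ denotes the output sequence generated by applying $\{u_k\}_{k=0}^{N-1}$ to $\Sigma$ with initial condition $x_0$. Output reachability: $\Sigma$ is output reachable if for any $\hat y\in\mathbb{R}^p$ there exist an integer $T\geq0$ and an input sequence $\{u_k\}_{k=0}^T$ such that $y_T(\Sigma,0,u)=\hat y$. $\bm{\Sigma}_{n,m,p}^{\mathrm{or}}$ denotes the set of all output reachable systems $(A,B,C,D)$ with $A\in\mathbb{R}^{n\times n}$, $B\in\mathbb{R}^{n\times m}$, $C\in\mathbb{R}^{p\times n}$, $D\in\mathbb{R}^{p\times m}$. Windows and Hankel matrix: $w_{[a,b]}=\begin{bmatrix}w_a^\top&\dots&w_b^\top\end{bmatrix}^\top$; for $\{w_k\}_{k=0}^{N-1}$ with $w_k\in\mathbb{R}^q$, $H_L(w)\in\mathbb{R}^{qL\times(N-L+1)}$ is the block Hankel matrix whose columns are $w_{[k,k+L-1]}$, $k=0,\dots,N-L$. Persistence of excitation: $\{w_k\}_{k=0}^{N-1}$ with $w_k\in\mathbb{R}^q$ is persistently exciting (PE) of order $L$ if $\mathrm{rank}(H_L(w))=qL$.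 It is $K$-persistently exciting ($K$-PE) of order $L$, for a symmetric matrix $K\succ0$, if $H_L(w)H_L(w)^\top=\sum_{k=0}^{N-L}w_{[k,k+L-1]}w_{[k,k+L-1]}^\top\succeq K$. The matrix $M$: for a given $\Sigma=(A,B,C,D)$, fix a polynomial $d(z)=\sum_{j=0}^n d_jz^{n-j}$ with real coefficients, $d_0\neq0$ and $d(A)=0$ (it exists by Cayley-Hamilton), with $d=\begin{bmatrix}d_n&\cdots&d_1&d_0\end{bmatrix}^\top\in\mathbb{R}^{n+1}$ normalized so that $\lVert d\rVert_2=1$. The Markov parameters are $\Gamma_0=D$, $\Gamma_i=CA^{i-1}B$ for $i=1,\dots,n$. Then $M=\begin{bmatrix}M_n&\dots&M_1&M_0\end{bmatrix}\in\mathbb{R}^{p\times m(n+1)}$ with $M_j=\sum_{q=0}^{j}d_{j-q}\Gamma_q$. *)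

theory Defs
  imports Complex_Main "Jordan_Normal_Form.DL_Rank"
begin

record lti_system =
  sysA :: "real mat"
  sysB :: "real mat"
  sysC :: "real mat"
  sysD :: "real mat"

definition lti_systems :: "nat \<Rightarrow> nat \<Rightarrow> nat \<Rightarrow> lti_system set" where
  "lti_systems n m p = {\<Sigma>. sysA \<Sigma> \<in> carrier_mat n n \<and> sysB \<Sigma> \<in> carrier_mat n m \<and>
     sysC \<Sigma> \<in> carrier_mat p n \<and> sysD \<Sigma> \<in> carrier_mat p m}"

primrec sys_state :: "lti_system \<Rightarrow> real vec \<Rightarrow> (nat \<Rightarrow> real vec) \<Rightarrow> nat \<Rightarrow> real vec" where
  "sys_state \<Sigma> x\<^sub>0 u 0 = x\<^sub>0"
| "sys_state \<Sigma> x\<^sub>0 u (Suc k) = sysA \<Sigma> *\<^sub>v sys_state \<Sigma> x\<^sub>0 u k + sysB \<Sigma> *\<^sub>v u k"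

definition sys_output :: "lti_system \<Rightarrow> real vec \<Rightarrow> (nat \<Rightarrow> real vec) \<Rightarrow> nat \<Rightarrow> real vec" where
  "sys_output \<Sigma> x\<^sub>0 u k = sysC \<Sigma> *\<^sub>v sys_state \<Sigma> x\<^sub>0 u k + sysD \<Sigma> *\<^sub>v u k"

(* A finite sequence w_0, ..., w_{N-1} in R^q is a function on nat of which only the
   values at k < N are constrained or used. *)
definition vec_seq :: "nat \<Rightarrow> nat \<Rightarrow> (nat \<Rightarrow> real vec) \<Rightarrow> bool" where
  "vec_seq q N w \<longleftrightarrow> (\<forall>k<N. w k \<in> carrier_vec q)"

definition output_reachable :: "lti_system \<Rightarrow> bool" where
  "output_reachable \<Sigma> \<longleftrightarrow> (\<forall>y \<in> carrier_vec (dim_row (sysC \<Sigma>)). \<exists>T u.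
     vec_seq (dim_col (sysB \<Sigma>)) (T + 1) u \<and> sys_output \<Sigma> (0\<^sub>v (dim_row (sysA \<Sigma>))) u T = y)"

definition output_reachable_systems :: "nat \<Rightarrow> nat \<Rightarrow> nat \<Rightarrow> lti_system set" where
  "output_reachable_systems n m p = {\<Sigma> \<in> lti_systems n m p. output_reachable \<Sigma>}"

definition window :: "nat \<Rightarrow> (nat \<Rightarrow> real vec) \<Rightarrow> nat \<Rightarrow> nat \<Rightarrow> real vec" where
  "window q w a b = vec (q * (b + 1 - a)) (\<lambda>i. w (a + i div q) $ (i mod q))"

(* For L > N the matrix has no columns, by truncated subtraction. *)
definition hankel :: "nat \<Rightarrow> nat \<Rightarrow> nat \<Rightarrow> (nat \<Rightarrow> real vec) \<Rightarrow> real mat" where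
  "hankel q N L w = mat_of_cols (q * L) (map (\<lambda>k. window q w k (k + L - 1)) [0..<N + 1 - L])"

definition persistently_exciting :: "nat \<Rightarrow> nat \<Rightarrow> nat \<Rightarrow> (nat \<Rightarrow> real vec) \<Rightarrow> bool" where
  "persistently_exciting q N L w \<longleftrightarrow>
     vec_seq q N w \<and> vec_space.rank (q * L) (hankel q N L w) = q * L"

definition pos_def :: "nat \<Rightarrow> real mat \<Rightarrow> bool" where
  "pos_def k K \<longleftrightarrow> K \<in> carrier_mat k k \<and> K\<^sup>T = K \<and>
     (\<forall>v \<in> carrier_vec k. v \<noteq> 0\<^sub>v k \<longrightarrow> v \<bullet> (K *\<^sub>v v) > 0)"

definition pos_semidef :: "nat \<Rightarrow> real mat \<Rightarrow> bool" where
  "pos_semidef k K \<longleftrightarrow> K \<in> carrier_mat k k \<and> K\<^sup>T = K \<and>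
     (\<forall>v \<in> carrier_vec k. v \<bullet> (K *\<^sub>v v) \<ge> 0)"

definition K_persistently_exciting ::
    "real mat \<Rightarrow> nat \<Rightarrow> nat \<Rightarrow> nat \<Rightarrow> (nat \<Rightarrow> real vec) \<Rightarrow> bool" where
  "K_persistently_exciting K q N L w \<longleftrightarrow> vec_seq q N w \<and> pos_def (q * L) K \<and>
     pos_semidef (q * L) (hankel q N L w * (hankel q N L w)\<^sup>T - K)"

definition mat_sum :: "nat \<Rightarrow> nat \<Rightarrow> ('i \<Rightarrow> real mat) \<Rightarrow> 'i set \<Rightarrow> real mat" where
  "mat_sum nr nc F I = mat nr nc (\<lambda>(r, c). \<Sum>i\<in>I. F i $$ (r, c))"

(* d j is the coefficient of z^(n-j); normalized means that the coefficient vector has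
   Euclidean norm 1. *)
definition normalized_annihilator :: "nat \<Rightarrow> real mat \<Rightarrow> (nat \<Rightarrow> real) \<Rightarrow> bool" where
  "normalized_annihilator n A d \<longleftrightarrow> d 0 \<noteq> 0 \<and>
     mat_sum n n (\<lambda>j. d j \<cdot>\<^sub>m (A ^\<^sub>m (n - j))) {0..n} = 0\<^sub>m n n \<and>
     sqrt (\<Sum>j=0..n. (d j)\<^sup>2) = 1"

fun markov :: "lti_system \<Rightarrow> nat \<Rightarrow> real mat" where
  "markov \<Sigma> 0 = sysD \<Sigma>"
| "markov \<Sigma> (Suc i) = sysC \<Sigma> * (sysA \<Sigma> ^\<^sub>m i) * sysB \<Sigma>"

definition M_block :: "nat \<Rightarrow> nat \<Rightarrow> lti_system \<Rightarrow> (nat \<Rightarrow> real) \<Rightarrow> nat \<Rightarrow> real mat" where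
  "M_block m p \<Sigma> d j = mat_sum p m (\<lambda>q. d (j - q) \<cdot>\<^sub>m markov \<Sigma> q) {0..j}"

(* The block row [M_n ... M_1 M_0]: the block at position l is M_(n-l). *)
definition M_mat :: "nat \<Rightarrow> nat \<Rightarrow> nat \<Rightarrow> lti_system \<Rightarrow> (nat \<Rightarrow> real) \<Rightarrow> real mat" where
  "M_mat n m p \<Sigma> d =
     mat p (m * (n + 1)) (\<lambda>(r, c). M_block m p \<Sigma> d (n - c div m) $$ (r, c mod m))"

end

(* Fix a direction \<xi> and look at the scalar signal s_k = \<xi> . y_k. Filtering the output with the
   coefficients of d cancels the free response, since d(A) = 0, and leaves
     sum_i d_(n-i) s_(k+i) = (M^T \<xi>) . u_[k,k+n].
   As d has norm 1, Cauchy-Schwarz bounds the squared left-hand side by the sum of the s_(k+i)^2, and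
   every s_j^2 occurs in at most n+1 windows, which gives the factor 1/(n+1). If M^T \<xi> = 0, then, as
   d_0 is nonzero, \<xi> kills all Markov parameters, hence all reachable outputs, so \<xi> = 0. Thus M has
   full row rank. The qualitative part follows from the same identity. There Cayley-Hamilton can be
   avoided: it suffices to annihilate the single row vector \<xi>^T C, and the n+1 vectors
   \<xi>^T C A^i in R^n are linearly dependent. *)
theory Submission
  imports Defs "HOL-Analysis.L2_Norm"
begin

section \<open>Gram matrices and full row rank\<close>

lemma gram_quadratic_form:
  fixes H :: "real mat"
  assumes H: "H \<in> carrier_mat nr nc" and v: "v \<in> carrier_vec nr"
  shows "v \<bullet> ((H * H\<^sup>T) *\<^sub>v v) = (\<Sum>j<nc. (col H j \<bullet> v)\<^sup>2)"
proof -
  have Hv: "H\<^sup>T *\<^sub>v v \<in> carrier_vec nc" using H v by simp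
  have "v \<bullet> ((H * H\<^sup>T) *\<^sub>v v) = v \<bullet> (H *\<^sub>v (H\<^sup>T *\<^sub>v v))"
    using H v by (simp add: assoc_mult_mat_vec[of _ nr nc])
  also have "\<dots> = (H\<^sup>T *\<^sub>v v) \<bullet> (H\<^sup>T *\<^sub>v v)"
    using transpose_vec_mult_scalar[OF H Hv v] by simp
  also have "\<dots> = (\<Sum>j<nc. (col H j \<bullet> v)\<^sup>2)"
    using H by (auto simp: scalar_prod_def[of "H\<^sup>T *\<^sub>v v"] power2_eq_square atLeast0LessThan)
  finally show ?thesis .
qed

text \<open>If the columns span, a vector v orthogonal to all of them is itself of the form H x, so
  v . v = (H^T v) . x = 0. The converse goes through the Gram matrix H H^T, whose quadratic form
  vanishes only on the left kernel of \<open>H\<close>.\<close>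

lemma full_rank_iff_left_kernel_trivial:
  fixes H :: "real mat"
  assumes H: "H \<in> carrier_mat nr nc"
  shows "vec_space.rank nr H = nr \<longleftrightarrow>
    (\<forall>v \<in> carrier_vec nr. (\<forall>j<nc. col H j \<bullet> v = 0) \<longrightarrow> v = 0\<^sub>v nr)"
    (is "?rank \<longleftrightarrow> ?ker")
proof -
  interpret vec_space "TYPE(real)" nr .
  have cols: "set (cols H) \<subseteq> carrier_vec nr" using H cols_dim by blast
  have ker_eq: "(\<forall>j<nc. col H j \<bullet> v = 0) \<longleftrightarrow> H\<^sup>T *\<^sub>v v = 0\<^sub>v nc" if "v \<in> carrier_vec nr" for v
    using H by (auto simp: vec_eq_iff)
  show ?thesis
  proof
    assume rk: ?rank
    obtain U where U: "finite U" "maximal U (\<lambda>T. T \<subseteq> set (cols H) \<and> lin_indpt T)"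
      using maximal_exists_superset[of "set (cols H)" "\<lambda>T. T \<subseteq> set (cols H) \<and> lin_indpt T" "{}"]
      by (auto simp: finite_lin_indpt2)
    have Usub: "U \<subseteq> set (cols H)" "lin_indpt U" using U(2) by (auto simp: maximal_def)
    have "card U = nr" using rank_card_indpt[OF H U(2)] rk by simp
    then have "basis U"
      using Usub cols U(1) dim_is_n by (intro dim_li_is_basis) auto
    then have "span U = carrier_vec nr" by (simp add: basis_def)
    then have "carrier_vec nr \<subseteq> col_space H"
      unfolding col_space_def using span_is_monotone[OF Usub(1)] by simp
    then have surj: "\<exists>x \<in> carrier_vec nc. H *\<^sub>v x = y" if "y \<in> carrier_vec nr" for y
      using that H unfolding col_space_eq[OF H] by auto
    show ?ker
    proof (intro ballI impI)
      fix v assume v: "v \<in> carrier_vec nr" and "\<forall>j<nc. col H j \<bullet> v = 0"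
      then have 0: "H\<^sup>T *\<^sub>v v = 0\<^sub>v nc" using ker_eq by blast
      obtain x where x: "x \<in> carrier_vec nc" "H *\<^sub>v x = v" using surj v by blast
      have "v \<bullet> v = 0"
        using transpose_vec_mult_scalar[OF H x(1) v] x 0 by simp
      then show "v = 0\<^sub>v nr" using v conjugate_square_eq_0_vec[OF v] by simp
    qed
  next
    assume ker: ?ker
    let ?G = "H * H\<^sup>T"
    have G: "?G \<in> carrier_mat nr nr" using H by auto
    \<comment> \<open>The Gram matrix is injective, hence invertible, and its range lies in the column space of H.\<close>
    have "det ?G \<noteq> 0"
    proof
      assume "det ?G = 0"
      then obtain v where v: "v \<in> carrier_vec nr" "v \<noteq> 0\<^sub>v nr" "?G *\<^sub>v v = 0\<^sub>v nr"
        using det_0_iff_vec_prod_zero_field[OF G] by blast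
      have "(\<Sum>j<nc. (col H j \<bullet> v)\<^sup>2) = 0"
        using gram_quadratic_form[OF H v(1)] v by simp
      then have "\<forall>j<nc. col H j \<bullet> v = 0"
        by (simp add: sum_nonneg_eq_0_iff)
      then show False using ker v by blast
    qed
    then have "?G \<in> Units (ring_mat TYPE(real) nr ())" by (rule det_non_zero_imp_unit[OF G])
    then obtain B where B: "B \<in> carrier_mat nr nr" "?G * B = 1\<^sub>m nr"
      by (auto simp: Units_def ring_mat_def)
    have "y \<in> col_space H" if y: "y \<in> carrier_vec nr" for y
    proof -
      have "H *\<^sub>v (H\<^sup>T *\<^sub>v (B *\<^sub>v y)) = (?G * B) *\<^sub>v y"
        using H B(1) y by (simp add: assoc_mult_mat_vec[OF G B(1) y] assoc_mult_mat_vec[of _ nr nc]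
            del: assoc_mult_mat)
      also have "\<dots> = y" using B y by simp
      finally show ?thesis unfolding col_space_eq[OF H] using H B y by auto
    qed
    then have "span (set (cols H)) = carrier_vec nr"
      using span_is_subset2[of "set (cols H)"] cols unfolding col_space_def by auto
    then have "span_vs (set (cols H)) = V" by (simp add: module_vec_def)
    then show ?rank unfolding rank_def using dim_is_n by simp
  qed
qed

section \<open>Hankel matrices and excitation, tested on single vectors\<close>

lemma window_carrier [simp]: "window q w k (k + n) \<in> carrier_vec (q * Suc n)"
  by (simp add: window_def)

text \<open>With the order written as \<open>Suc n\<close>, windows end at \<open>k + n\<close> and
  \<open>N - n\<close> columns remain. For N \<le> n the truncated difference is 0, so no window
  ever runs past the end of the sequence.\<close>

lemma hankel_carrier [simp]: "hankel q N (Suc n) w \<in> carrier_mat (q * Suc n) (N - n)"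
  by (simp add: hankel_def mat_of_cols_def)

lemma col_hankel: "k < N - n \<Longrightarrow> col (hankel q N (Suc n) w) k = window q w k (k + n)"
  unfolding hankel_def by (subst col_mat_of_cols) (auto simp del: upt_Suc mult_Suc_right)

text \<open>Replaces the rank by a test on one vector at a time, which allows a single direction
  \<xi> to be fixed when the outputs are studied.\<close>

lemma persistently_exciting_iff:
  "persistently_exciting q N (Suc n) w \<longleftrightarrow> vec_seq q N w \<and>
     (\<forall>v \<in> carrier_vec (q * Suc n).
        (\<forall>k<N - n. window q w k (k + n) \<bullet> v = 0) \<longrightarrow> v = 0\<^sub>v (q * Suc n))"
  unfolding persistently_exciting_def full_rank_iff_left_kernel_trivial[OF hankel_carrier]
  by (simp add: col_hankel)

lemma hankel_quadratic_form:
  assumes "v \<in> carrier_vec (q * Suc n)"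
  shows "v \<bullet> ((hankel q N (Suc n) w * (hankel q N (Suc n) w)\<^sup>T) *\<^sub>v v) =
    (\<Sum>k<N - n. (window q w k (k + n) \<bullet> v)\<^sup>2)"
  unfolding gram_quadratic_form[OF hankel_carrier assms] by (simp add: col_hankel)

text \<open>The matrix inequality becomes a comparison of quadratic forms through
  \<open>hankel_quadratic_form\<close>; the difference is symmetric because the Gram matrix and
  \<open>K\<close> are.\<close>

lemma K_persistently_exciting_iff:
  "K_persistently_exciting K q N (Suc n) w \<longleftrightarrow> vec_seq q N w \<and> pos_def (q * Suc n) K \<and>
     (\<forall>v \<in> carrier_vec (q * Suc n).
        v \<bullet> (K *\<^sub>v v) \<le> (\<Sum>k<N - n. (window q w k (k + n) \<bullet> v)\<^sup>2))"
proof -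
  let ?H = "hankel q N (Suc n) w"
  let ?r = "q * Suc n"
  have H: "?H \<in> carrier_mat ?r (N - n)" by (rule hankel_carrier)
  have G: "?H * ?H\<^sup>T \<in> carrier_mat ?r ?r" using H transpose_carrier_mat mult_carrier_mat by blast
  have sym: "(?H * ?H\<^sup>T)\<^sup>T = ?H * ?H\<^sup>T" 
    using transpose_mult[OF H, of "?H\<^sup>T" ?r] H by simp
  have "pos_semidef ?r (?H * ?H\<^sup>T - K) \<longleftrightarrow>
    (\<forall>v \<in> carrier_vec ?r. v \<bullet> (K *\<^sub>v v) \<le> (\<Sum>k<N - n. (window q w k (k + n) \<bullet> v)\<^sup>2))"
    if "pos_def ?r K"
  proof -
    have K: "K \<in> carrier_mat ?r ?r" "K\<^sup>T = K" using that by (auto simp: pos_def_def)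
    have "v \<bullet> ((?H * ?H\<^sup>T - K) *\<^sub>v v) =
      (\<Sum>k<N - n. (window q w k (k + n) \<bullet> v)\<^sup>2) - v \<bullet> (K *\<^sub>v v)"
      if v: "v \<in> carrier_vec ?r" for v
    proof -
      have "(?H * ?H\<^sup>T - K) *\<^sub>v v = (?H * ?H\<^sup>T) *\<^sub>v v - K *\<^sub>v v"
        using minus_mult_distrib_mat_vec[OF G K(1) v] .
      moreover have "v \<bullet> ((?H * ?H\<^sup>T) *\<^sub>v v - K *\<^sub>v v) = v \<bullet> ((?H * ?H\<^sup>T) *\<^sub>v v) - v \<bullet> (K *\<^sub>v v)"
        by (rule scalar_prod_minus_distrib[OF v]) (use G K v mult_mat_vec_carrier in blast)+
      ultimately show ?thesis by (simp only: hankel_quadratic_form[OF v])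
    qed
    moreover have "(?H * ?H\<^sup>T - K)\<^sup>T = ?H * ?H\<^sup>T - K"
      using transpose_minus[OF G K(1)] sym K by simp
    ultimately show ?thesis unfolding pos_semidef_def using K G by auto
  qed
  then show ?thesis unfolding K_persistently_exciting_def by blast
qed

lemma window_block:
  assumes "vec_seq m N u" "k + l < N" "l \<le> n"
  shows "vec m (\<lambda>a. window m u k (k + n) $ (l * m + a)) = u (k + l)"
proof (rule eq_vecI)
  have u: "u (k + l) \<in> carrier_vec m" using assms by (simp add: vec_seq_def)
  then show "dim_vec (vec m (\<lambda>a. window m u k (k + n) $ (l * m + a))) = dim_vec (u (k + l))" by simp
  fix a assume "a < dim_vec (u (k + l))"
  then have a: "a < m" using u by simp
  have "l * m + a < l * m + m" using a by simp
  also have "\<dots> \<le> m * Suc n" using mult_le_mono1[of "Suc l" "Suc n" m] assms(3) by (simp add: mult.commute)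
  finally show "vec m (\<lambda>a. window m u k (k + n) $ (l * m + a)) $ a = u (k + l) $ a"
    using a by (simp add: window_def)
qed

lemma window_one:
  assumes "w k \<in> carrier_vec q"
  shows "window q w k k = w k"
  using assms by (intro eq_vecI) (auto simp: window_def)


lemma congruence_quadratic_form:
  fixes M K :: "real mat"
  assumes M: "M \<in> carrier_mat p r" and K: "K \<in> carrier_mat r r" and v: "v \<in> carrier_vec p"
  shows "v \<bullet> ((c \<cdot>\<^sub>m (M * K * M\<^sup>T)) *\<^sub>v v) = c * ((M\<^sup>T *\<^sub>v v) \<bullet> (K *\<^sub>v (M\<^sup>T *\<^sub>v v)))"
proof -
  have Mt: "M\<^sup>T \<in> carrier_mat r p" using M by simp
  have MK: "M * K \<in> carrier_mat p r" using M K by simp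
  have x: "M\<^sup>T *\<^sub>v v \<in> carrier_vec r" using Mt v by simp
  have "(c \<cdot>\<^sub>m (M * K * M\<^sup>T)) *\<^sub>v v = c \<cdot>\<^sub>v (M *\<^sub>v (K *\<^sub>v (M\<^sup>T *\<^sub>v v)))"
    using assoc_mult_mat_vec[OF MK Mt v] assoc_mult_mat_vec[OF M K x] mult_carrier_mat[OF MK Mt] v
    by (auto simp: vec_eq_iff)
  then show ?thesis
    using transpose_vec_mult_scalar[OF M mult_mat_vec_carrier[OF K x] v] v M by simp
qed

text \<open>After swapping the sums, each offset i \<le> n contributes the values of
  \<open>f\<close> at distinct indices below \<open>N\<close>, hence at most the full sum since
  \<open>f\<close> is nonnegative. There are n+1 offsets.\<close>

lemma sum_windows_le:
  fixes f :: "nat \<Rightarrow> real"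
  assumes "\<And>k. 0 \<le> f k"
  shows "(\<Sum>k<N - n. \<Sum>i\<le>n. f (k + i)) \<le> real (Suc n) * (\<Sum>k<N. f k)"
proof -
  have "(\<Sum>k<N - n. f (k + i)) \<le> (\<Sum>k<N. f k)" if "i \<le> n" for i
  proof -
    have "(\<Sum>k<N - n. f (k + i)) = sum f ((\<lambda>k. k + i) ` {..<N - n})"
      by (simp add: sum.reindex)
    also have "\<dots> \<le> (\<Sum>k<N. f k)"
      using that assms by (intro sum_mono2) auto
    finally show ?thesis .
  qed
  then have "(\<Sum>i\<le>n. \<Sum>k<N - n. f (k + i)) \<le> (\<Sum>i\<le>n. \<Sum>k<N. f k)"
    by (intro sum_mono) simp
  then show ?thesis by (subst sum.swap) simp
qed

section \<open>The output observed in a fixed direction \<xi>\<close>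

locale observed_lti =
  fixes n m p :: nat and \<Sigma> :: lti_system and \<xi> :: "real vec"
  assumes sys: "\<Sigma> \<in> lti_systems n m p"
    and \<xi>: "\<xi> \<in> carrier_vec p"
begin

lemma dims [simp]:
  "sysA \<Sigma> \<in> carrier_mat n n" "sysB \<Sigma> \<in> carrier_mat n m"
  "sysC \<Sigma> \<in> carrier_mat p n" "sysD \<Sigma> \<in> carrier_mat p m"
  using sys by (auto simp: lti_systems_def)

lemma pow_A [simp]: "sysA \<Sigma> ^\<^sub>m i \<in> carrier_mat n n"
  by (simp add: pow_carrier_mat)

lemma markov_carrier [simp]: "markov \<Sigma> q \<in> carrier_mat p m"
proof (cases q)
  case (Suc i)
  have "sysC \<Sigma> * (sysA \<Sigma> ^\<^sub>m i) \<in> carrier_mat p n" by (rule mult_carrier_mat[OF dims(3) pow_A])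
  then show ?thesis using Suc by (auto intro: mult_carrier_mat dims)
qed simp

definition free_response :: "nat \<Rightarrow> real vec \<Rightarrow> real" where
  "free_response i x = \<xi> \<bullet> (sysC \<Sigma> *\<^sub>v ((sysA \<Sigma> ^\<^sub>m i) *\<^sub>v x))"

definition impulse_response :: "nat \<Rightarrow> real vec \<Rightarrow> real" where
  "impulse_response q v = \<xi> \<bullet> (markov \<Sigma> q *\<^sub>v v)"

text \<open>The row vector \<open>\<xi>\<^sup>T C d(A)\<close> vanishes, with \<open>d\<close> indexed as in \<^const>\<open>normalized_annihilator\<close>.\<close>

definition annihilates :: "(nat \<Rightarrow> real) \<Rightarrow> bool" where
  "annihilates d \<longleftrightarrow> (\<forall>x \<in> carrier_vec n. (\<Sum>j\<le>n. d j * free_response (n - j) x) = 0)"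

lemma Ax_carrier [simp]: "x \<in> carrier_vec n \<Longrightarrow> sysA \<Sigma> *\<^sub>v x \<in> carrier_vec n"
  by (rule mult_mat_vec_carrier[OF dims(1)])

lemma powAx_carrier [simp]: "x \<in> carrier_vec n \<Longrightarrow> (sysA \<Sigma> ^\<^sub>m i) *\<^sub>v x \<in> carrier_vec n"
  by (rule mult_mat_vec_carrier[OF pow_A])

lemma Bv_carrier [simp]: "v \<in> carrier_vec m \<Longrightarrow> sysB \<Sigma> *\<^sub>v v \<in> carrier_vec n"
  by (rule mult_mat_vec_carrier[OF dims(2)])

lemma free_response_Suc:
  "x \<in> carrier_vec n \<Longrightarrow> free_response (Suc i) x = free_response i (sysA \<Sigma> *\<^sub>v x)"
  unfolding free_response_def using assoc_mult_mat_vec[OF pow_A dims(1)] by simp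

lemma free_response_pow:
  "x \<in> carrier_vec n \<Longrightarrow> free_response i ((sysA \<Sigma> ^\<^sub>m k) *\<^sub>v x) = free_response (i + k) x"
proof (induction k arbitrary: x)
  case 0
  have "sysA \<Sigma> ^\<^sub>m 0 = 1\<^sub>m n" using carrier_matD(1)[OF dims(1)] by simp
  then show ?case using 0 by (simp add: one_mult_mat_vec)
next
  case (Suc k)
  have "(sysA \<Sigma> ^\<^sub>m Suc k) *\<^sub>v x = (sysA \<Sigma> ^\<^sub>m k) *\<^sub>v (sysA \<Sigma> *\<^sub>v x)"
    using assoc_mult_mat_vec[OF pow_A dims(1) Suc.prems] by simp
  then show ?case using Suc by (simp add: free_response_Suc)
qed

lemma free_response_add:
  assumes "x \<in> carrier_vec n" "y \<in> carrier_vec n"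
  shows "free_response i (x + y) = free_response i x + free_response i y"
proof -
  have "(sysA \<Sigma> ^\<^sub>m i) *\<^sub>v (x + y) = (sysA \<Sigma> ^\<^sub>m i) *\<^sub>v x + (sysA \<Sigma> ^\<^sub>m i) *\<^sub>v y"
    by (rule mult_add_distrib_mat_vec[OF pow_A assms])
  then have "sysC \<Sigma> *\<^sub>v ((sysA \<Sigma> ^\<^sub>m i) *\<^sub>v (x + y)) =
      sysC \<Sigma> *\<^sub>v ((sysA \<Sigma> ^\<^sub>m i) *\<^sub>v x) + sysC \<Sigma> *\<^sub>v ((sysA \<Sigma> ^\<^sub>m i) *\<^sub>v y)"
    using mult_add_distrib_mat_vec[OF dims(3) powAx_carrier powAx_carrier] assms by simp
  then show ?thesis unfolding free_response_def
    using assms by (simp add: scalar_prod_add_distrib[OF \<xi>] mult_mat_vec_carrier[OF dims(3)])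
qed

lemma free_response_zero: "free_response i (0\<^sub>v n) = 0"
  using free_response_add[of "0\<^sub>v n" "0\<^sub>v n" i] by simp

text \<open>An impulse v moves the state to B v one step later, and from there it evolves freely;
  this explains the index shift.\<close>

lemma impulse_response_Suc:
  assumes v: "v \<in> carrier_vec m"
  shows "impulse_response (Suc i) v = free_response i (sysB \<Sigma> *\<^sub>v v)"
proof -
  have CA: "sysC \<Sigma> * (sysA \<Sigma> ^\<^sub>m i) \<in> carrier_mat p n" by (rule mult_carrier_mat[OF dims(3) pow_A])
  have "sysC \<Sigma> * (sysA \<Sigma> ^\<^sub>m i) * sysB \<Sigma> *\<^sub>v v = sysC \<Sigma> * (sysA \<Sigma> ^\<^sub>m i) *\<^sub>v (sysB \<Sigma> *\<^sub>v v)"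
    by (rule assoc_mult_mat_vec[OF CA dims(2) v])
  also have "\<dots> = sysC \<Sigma> *\<^sub>v ((sysA \<Sigma> ^\<^sub>m i) *\<^sub>v (sysB \<Sigma> *\<^sub>v v))"
    by (rule assoc_mult_mat_vec[OF dims(3) pow_A Bv_carrier[OF v]])
  finally show ?thesis by (simp add: impulse_response_def free_response_def)
qed

lemma state_carrier:
  assumes "vec_seq m N u" "x\<^sub>0 \<in> carrier_vec n"
  shows "k \<le> N \<Longrightarrow> sys_state \<Sigma> x\<^sub>0 u k \<in> carrier_vec n"
proof (induction k)
  case (Suc k)
  then have "u k \<in> carrier_vec m" using assms by (simp add: vec_seq_def)
  then show ?case using Suc by simp
qed (use assms in simp)

lemma output_carrier:
  assumes "vec_seq m N u" "x\<^sub>0 \<in> carrier_vec n"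
  shows "vec_seq p N (sys_output \<Sigma> x\<^sub>0 u)"
proof -
  have "sys_output \<Sigma> x\<^sub>0 u k \<in> carrier_vec p" if "k < N" for k
    unfolding sys_output_def
    by (intro add_carrier_vec mult_mat_vec_carrier[OF dims(3)] mult_mat_vec_carrier[OF dims(4)])
       (use that assms state_carrier[OF assms] in \<open>auto simp: vec_seq_def\<close>)
  then show ?thesis by (simp add: vec_seq_def)
qed

text \<open>Variation of constants started at time \<open>k\<close>. The induction step applies the
  hypothesis at \<open>Suc k\<close>, which is why \<open>k\<close> is arbitrary, and splits the
  state A x + B u by additivity: the first part is a free response with index raised by one, the
  second is the new impulse term.\<close>

lemma output_expansion:
  assumes u: "vec_seq m N u" and x0: "x\<^sub>0 \<in> carrier_vec n"
  shows "k + i < N \<Longrightarrow> \<xi> \<bullet> sys_output \<Sigma> x\<^sub>0 u (k + i) =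
    free_response i (sys_state \<Sigma> x\<^sub>0 u k) + (\<Sum>q\<le>i. impulse_response q (u (k + i - q)))"
proof (induction i arbitrary: k)
  case 0
  have x: "sys_state \<Sigma> x\<^sub>0 u k \<in> carrier_vec n" using state_carrier[OF u x0] 0 by simp
  have uk: "u k \<in> carrier_vec m" using u 0 by (simp add: vec_seq_def)
  have "sysA \<Sigma> ^\<^sub>m 0 = 1\<^sub>m n" using carrier_matD(1)[OF dims(1)] by simp
  then have "free_response 0 (sys_state \<Sigma> x\<^sub>0 u k) = \<xi> \<bullet> (sysC \<Sigma> *\<^sub>v sys_state \<Sigma> x\<^sub>0 u k)"
    using x by (simp add: free_response_def)
  then show ?case
    using scalar_prod_add_distrib[OF \<xi> mult_mat_vec_carrier[OF dims(3) x] mult_mat_vec_carrier[OF dims(4) uk]]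
    by (simp add: sys_output_def impulse_response_def)
next
  case (Suc i)
  have x: "sys_state \<Sigma> x\<^sub>0 u k \<in> carrier_vec n" using state_carrier[OF u x0] Suc.prems by simp
  have uk: "u k \<in> carrier_vec m" using u Suc.prems by (simp add: vec_seq_def)
  have "\<xi> \<bullet> sys_output \<Sigma> x\<^sub>0 u (k + Suc i) = free_response i (sys_state \<Sigma> x\<^sub>0 u (Suc k)) +
      (\<Sum>q\<le>i. impulse_response q (u (k + Suc i - q)))"
    using Suc.IH[of "Suc k"] Suc.prems by simp
  also have "free_response i (sys_state \<Sigma> x\<^sub>0 u (Suc k)) =
      free_response (Suc i) (sys_state \<Sigma> x\<^sub>0 u k) + impulse_response (Suc i) (u k)"
    using x uk by (simp add: free_response_add free_response_Suc impulse_response_Suc)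
  finally show ?case by simp
qed

text \<open>Reading the filter weights backwards turns the free-response terms into the sum that
  \<open>annihilates\<close> makes zero, so only the inputs inside the window remain.\<close>

lemma filtered_output:
  assumes u: "vec_seq m N u" and x0: "x\<^sub>0 \<in> carrier_vec n" and d: "annihilates d" and k: "k + n < N"
  shows "(\<Sum>i\<le>n. d (n - i) * (\<xi> \<bullet> sys_output \<Sigma> x\<^sub>0 u (k + i))) =
    (\<Sum>l\<le>n. \<Sum>q\<le>n - l. d (n - l - q) * impulse_response q (u (k + l)))"
proof -
  let ?x = "sys_state \<Sigma> x\<^sub>0 u k"
  have x: "?x \<in> carrier_vec n" using state_carrier[OF u x0] k by simp
  have "(\<Sum>i\<le>n. d (n - i) * free_response i ?x) = (\<Sum>j\<le>n. d j * free_response (n - j) ?x)"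
    by (rule sum.reindex_bij_witness[of _ "\<lambda>j. n - j" "\<lambda>i. n - i"]) auto
  also have "\<dots> = 0" using d x by (simp add: annihilates_def)
  finally have free: "(\<Sum>i\<le>n. d (n - i) * free_response i ?x) = 0" .
  have "(\<Sum>i\<le>n. d (n - i) * (\<xi> \<bullet> sys_output \<Sigma> x\<^sub>0 u (k + i))) =
    (\<Sum>i\<le>n. d (n - i) * free_response i ?x + (\<Sum>q\<le>i. d (n - i) * impulse_response q (u (k + i - q))))"
    using k by (intro sum.cong) (auto simp: output_expansion[OF u x0] distrib_left sum_distrib_left)
  also have "\<dots> = (\<Sum>i\<le>n. \<Sum>q\<le>i. d (n - i) * impulse_response q (u (k + i - q)))"
    by (simp add: sum.distrib free)
  \<comment> \<open>Regroup by the offset l = i - q of the input that is hit; then n - i = n - l -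
    q.\<close>
  also have "\<dots> = (\<Sum>l\<le>n. \<Sum>q\<le>n - l. d (n - l - q) * impulse_response q (u (k + l)))"
    unfolding sum.Sigma[OF finite_atMost ballI[OF finite_atMost]]
    by (rule sum.reindex_bij_witness[of _ "\<lambda>(l, q). (l + q, q)" "\<lambda>(i, q). (i - q, q)"])
       (auto simp: diff_diff_eq)
  finally show ?thesis .
qed

text \<open>For q \<le> n the assumed relations form a triangular system with d 0 on the diagonal.
  Beyond n, annihilation is a linear recurrence that determines each response from the n preceding
  ones, again with leading coefficient d 0.\<close>

lemma impulse_response_eq_0:
  assumes d0: "d 0 \<noteq> 0" and d: "annihilates d"
    and M: "\<And>j v. j \<le> n \<Longrightarrow> v \<in> carrier_vec m \<Longrightarrow> (\<Sum>q\<le>j. d (j - q) * impulse_response q v) = 0"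
    and v: "v \<in> carrier_vec m"
  shows "impulse_response q v = 0"
proof (induction q rule: less_induct)
  case (less q)
  show ?case
  proof (cases "q \<le> n")
    case True
    have "(\<Sum>r\<le>q. d (q - r) * impulse_response r v) = d 0 * impulse_response q v"
      using less by (simp add: lessThan_Suc_atMost[symmetric])
    then show ?thesis using M[OF True v] d0 by simp
  next
    case False
    \<comment> \<open>Chosen so that its free response at n - j is the impulse response at q - j. As
      q > n, the subtractions are genuine and q - j \<ge> 1, so the feedthrough D does not
      enter.\<close>
    let ?x = "(sysA \<Sigma> ^\<^sub>m (q - 1 - n)) *\<^sub>v (sysB \<Sigma> *\<^sub>v v)"
    have "free_response (n - j) ?x = impulse_response (q - j) v" if "j \<le> n" for j
    proof -
      have "q - j = Suc (n - j + (q - 1 - n))" using that False by simp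
      then show ?thesis using v by (simp add: free_response_pow impulse_response_Suc)
    qed
    then have "(\<Sum>j\<le>n. d j * impulse_response (q - j) v) = (\<Sum>j\<le>n. d j * free_response (n - j) ?x)"
      by simp
    also have "\<dots> = 0"
      using d[unfolded annihilates_def, rule_format, of ?x] v by simp
    finally have "0 = (\<Sum>j\<le>n. d j * impulse_response (q - j) v)" ..
    also have "\<dots> = d 0 * impulse_response q v + (\<Sum>j\<in>{..n} - {0}. d j * impulse_response (q - j) v)"
      by (subst sum.remove[of _ 0]) auto
    also have "(\<Sum>j\<in>{..n} - {0}. d j * impulse_response (q - j) v) = 0"
      using less False by (intro sum.neutral) auto
    finally show ?thesis using d0 by simp
  qed
qed

text \<open>Steer the zero state to the output \<xi> itself: then \<xi> . \<xi> is a sum of impulse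
  responses, all of which vanish.\<close>

lemma output_reachable_imp_eq_0:
  assumes r: "output_reachable \<Sigma>"
    and 0: "\<And>q v. v \<in> carrier_vec m \<Longrightarrow> impulse_response q v = 0"
  shows "\<xi> = 0\<^sub>v p"
proof -
  obtain T u where u: "vec_seq m (T + 1) u" and y: "sys_output \<Sigma> (0\<^sub>v n) u T = \<xi>"
    using r \<xi> dims unfolding output_reachable_def by fastforce
  have "\<xi> \<bullet> \<xi> = free_response T (0\<^sub>v n) + (\<Sum>q\<le>T. impulse_response q (u (T - q)))"
    using output_expansion[OF u, of "0\<^sub>v n" 0 T] y by simp
  also have "\<dots> = 0" using u by (auto simp: free_response_zero vec_seq_def intro!: sum.neutral 0)
  finally show ?thesis using conjugate_square_eq_0_vec[OF \<xi>] by simp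
qed

section \<open>The matrix M and its left kernel\<close>

text \<open>Grouping the columns as c = l * m + a exposes block M_(n-l), which is then expanded into
  Markov parameters. The result has the shape of the right-hand side of
  \<open>filtered_output\<close>, with block l of \<open>w\<close> in place of the input at offset
  l.\<close>

lemma M_mat_form:
  assumes w: "w \<in> carrier_vec (m * Suc n)"
  shows "\<xi> \<bullet> (M_mat n m p \<Sigma> d *\<^sub>v w) =
    (\<Sum>l\<le>n. \<Sum>q\<le>n - l. d (n - l - q) * impulse_response q (vec m (\<lambda>a. w $ (l * m + a))))"
proof -
  have row: "(M_mat n m p \<Sigma> d *\<^sub>v w) $ r =
      (\<Sum>l\<le>n. \<Sum>q\<le>n - l. d (n - l - q) * (markov \<Sigma> q *\<^sub>v vec m (\<lambda>a. w $ (l * m + a))) $ r)"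
    if r: "r < p" for r
  proof -
    let ?f = "\<lambda>c. M_block m p \<Sigma> d (n - c div m) $$ (r, c mod m) * w $ c"
    have "(M_mat n m p \<Sigma> d *\<^sub>v w) $ r = (\<Sum>c<Suc n * m. ?f c)"
      using r w by (auto simp: M_mat_def scalar_prod_def atLeast0LessThan mult.commute intro!: sum.cong)
    also have "\<dots> = (\<Sum>l<Suc n. sum ?f {l * m..<l * m + m})"
      by (rule sum.nat_group[symmetric])
    also have "\<dots> = (\<Sum>l<Suc n. \<Sum>a<m. ?f (l * m + a))"
    proof (rule sum.cong[OF refl])
      fix l
      show "sum ?f {l * m..<l * m + m} = (\<Sum>a<m. ?f (l * m + a))"
        by (rule sum.reindex_bij_witness[of _ "\<lambda>a. l * m + a" "\<lambda>c. c - l * m"]) auto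
    qed
    also have "\<dots> = (\<Sum>l<Suc n. \<Sum>a<m. \<Sum>q\<le>n - l. d (n - l - q) * markov \<Sigma> q $$ (r, a) * w $ (l * m + a))"
    proof (intro sum.cong refl)
      fix l a assume "a \<in> {..<m}"
      then have a: "a < m" by simp
      have mk: "r < dim_row (markov \<Sigma> q)" "a < dim_col (markov \<Sigma> q)" for q
        using markov_carrier[of q] r a by (auto simp del: markov_carrier)
      show "?f (l * m + a) = (\<Sum>q\<le>n - l. d (n - l - q) * markov \<Sigma> q $$ (r, a) * w $ (l * m + a))"
        using a r mk by (simp add: M_block_def mat_sum_def sum_distrib_right atLeast0AtMost)
    qed
    also have "\<dots> = (\<Sum>l<Suc n. \<Sum>q\<le>n - l. \<Sum>a<m. d (n - l - q) * markov \<Sigma> q $$ (r, a) * w $ (l * m + a))"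
      by (intro sum.cong refl sum.swap)
    also have "\<dots> = (\<Sum>l<Suc n. \<Sum>q\<le>n - l. d (n - l - q) * (markov \<Sigma> q *\<^sub>v vec m (\<lambda>a. w $ (l * m + a))) $ r)"
    proof (intro sum.cong refl)
      fix l q
      show "(\<Sum>a<m. d (n - l - q) * markov \<Sigma> q $$ (r, a) * w $ (l * m + a)) =
        d (n - l - q) * (markov \<Sigma> q *\<^sub>v vec m (\<lambda>a. w $ (l * m + a))) $ r"
        using r carrier_matD[OF markov_carrier[of q]]
        by (auto simp: scalar_prod_def sum_distrib_left atLeast0LessThan mult.assoc intro!: sum.cong)
    qed
    finally show ?thesis by (simp add: lessThan_Suc_atMost)
  qed
  have "\<xi> \<bullet> (M_mat n m p \<Sigma> d *\<^sub>v w) = (\<Sum>r<p. \<xi> $ r * (M_mat n m p \<Sigma> d *\<^sub>v w) $ r)"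
    by (simp add: scalar_prod_def[of \<xi>] M_mat_def atLeast0LessThan)
  also have "\<dots> = (\<Sum>r<p. \<Sum>l\<le>n. \<Sum>q\<le>n - l. d (n - l - q) *
      (\<xi> $ r * (markov \<Sigma> q *\<^sub>v vec m (\<lambda>a. w $ (l * m + a))) $ r))"
    by (intro sum.cong refl) (simp add: row sum_distrib_left mult.left_commute del: index_mult_mat_vec)
  also have "\<dots> = (\<Sum>l\<le>n. \<Sum>r<p. \<Sum>q\<le>n - l. d (n - l - q) *
      (\<xi> $ r * (markov \<Sigma> q *\<^sub>v vec m (\<lambda>a. w $ (l * m + a))) $ r))"
    by (rule sum.swap)
  also have "\<dots> = (\<Sum>l\<le>n. \<Sum>q\<le>n - l. \<Sum>r<p. d (n - l - q) *
      (\<xi> $ r * (markov \<Sigma> q *\<^sub>v vec m (\<lambda>a. w $ (l * m + a))) $ r))"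
    by (intro sum.cong refl sum.swap)
  also have "\<dots> = (\<Sum>l\<le>n. \<Sum>q\<le>n - l. d (n - l - q) * impulse_response q (vec m (\<lambda>a. w $ (l * m + a))))"
  proof (intro sum.cong refl)
    fix l q
    have "dim_vec (markov \<Sigma> q *\<^sub>v vec m (\<lambda>a. w $ (l * m + a))) = p"
      using carrier_matD[OF markov_carrier[of q]] by simp
    then show "(\<Sum>r<p. d (n - l - q) * (\<xi> $ r * (markov \<Sigma> q *\<^sub>v vec m (\<lambda>a. w $ (l * m + a))) $ r)) =
      d (n - l - q) * impulse_response q (vec m (\<lambda>a. w $ (l * m + a)))"
      by (simp add: impulse_response_def scalar_prod_def[of \<xi>] sum_distrib_left atLeast0LessThan
          del: index_mult_mat_vec)
  qed
  finally show ?thesis .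
qed

lemma M_mat_carrier: "M_mat n m p \<Sigma> d \<in> carrier_mat p (m * Suc n)"
  by (simp add: M_mat_def)

lemma M_mat_transpose_form:
  assumes "w \<in> carrier_vec (m * Suc n)"
  shows "w \<bullet> ((M_mat n m p \<Sigma> d)\<^sup>T *\<^sub>v \<xi>) = \<xi> \<bullet> (M_mat n m p \<Sigma> d *\<^sub>v w)"
proof -
  have "(M_mat n m p \<Sigma> d)\<^sup>T *\<^sub>v \<xi> \<in> carrier_vec (m * Suc n)"
    using M_mat_carrier \<xi> by (metis mult_mat_vec_carrier transpose_carrier_mat)
  then show ?thesis
    using comm_scalar_prod[OF assms] transpose_vec_mult_scalar[OF M_mat_carrier assms \<xi>] by simp
qed

text \<open>Block l of the window is the input at time k + l, so \<open>M_mat_form\<close> and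
  \<open>filtered_output\<close> give the same double sum. Both claims of the theorem rest on this
  identity.\<close>

lemma window_filtered_output:
  assumes u: "vec_seq m N u" and x0: "x\<^sub>0 \<in> carrier_vec n" and d: "annihilates d" and k: "k + n < N"
  shows "window m u k (k + n) \<bullet> ((M_mat n m p \<Sigma> d)\<^sup>T *\<^sub>v \<xi>) =
    (\<Sum>i\<le>n. d (n - i) * (\<xi> \<bullet> sys_output \<Sigma> x\<^sub>0 u (k + i)))"
  unfolding M_mat_transpose_form[OF window_carrier] M_mat_form[OF window_carrier]
    filtered_output[OF assms]
  using k by (intro sum.cong refl) (auto simp: window_block[OF u])

text \<open>This is full row rank of M. Testing M^T \<xi> = 0 block by block yields \<xi>^T M_j = 0
  for every j \<le> n, which is the triangular system of \<open>impulse_response_eq_0\<close>;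
  output reachability then forces \<xi> = 0.\<close>

lemma M_mat_transpose_eq_0:
  assumes r: "output_reachable \<Sigma>" and d0: "d 0 \<noteq> 0" and d: "annihilates d"
    and M: "(M_mat n m p \<Sigma> d)\<^sup>T *\<^sub>v \<xi> = 0\<^sub>v (m * Suc n)"
  shows "\<xi> = 0\<^sub>v p"
proof (rule output_reachable_imp_eq_0[OF r])
  have imp_0: "impulse_response q (0\<^sub>v m) = 0" for q
  proof -
    have "markov \<Sigma> q *\<^sub>v 0\<^sub>v m = 0\<^sub>v p" using markov_carrier[of q] by (auto simp del: markov_carrier)
    then show ?thesis using \<xi> by (simp add: impulse_response_def)
  qed
  have "(\<Sum>q\<le>j. d (j - q) * impulse_response q v) = 0" if j: "j \<le> n" and v: "v \<in> carrier_vec m" for j v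
  proof -
    \<comment> \<open>The block of M at position n - j is M_j, so placing v there and zeros
      elsewhere isolates \<xi>^T M_j v.\<close>
    define w where "w = vec (m * Suc n) (\<lambda>c. if c div m = n - j then v $ (c mod m) else 0)"
    have w: "w \<in> carrier_vec (m * Suc n)" by (simp add: w_def)
    have block: "vec m (\<lambda>a. w $ (l * m + a)) = (if l = n - j then v else 0\<^sub>v m)" if "l \<le> n" for l
    proof -
      have "l * m + a < m * Suc n" if "a < m" for a
      proof -
        have "l * m + a < Suc l * m" using that by simp
        also have "\<dots> \<le> m * Suc n" using mult_le_mono1[of "Suc l" "Suc n" m] \<open>l \<le> n\<close> by (simp add: mult.commute)
        finally show ?thesis .
      qed
      then show ?thesis using v by (auto simp: w_def vec_eq_iff)
    qed
    have "0 = w \<bullet> ((M_mat n m p \<Sigma> d)\<^sup>T *\<^sub>v \<xi>)" using M w by simp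
    also have "\<dots> = (\<Sum>l\<le>n. \<Sum>q\<le>n - l. d (n - l - q) * impulse_response q (if l = n - j then v else 0\<^sub>v m))"
      unfolding M_mat_transpose_form[OF w] M_mat_form[OF w] by (intro sum.cong refl) (simp add: block)
    also have "\<dots> = (\<Sum>l\<le>n. if l = n - j then \<Sum>q\<le>n - l. d (n - l - q) * impulse_response q v else 0)"
      by (intro sum.cong refl) (auto simp: imp_0)
    also have "\<dots> = (\<Sum>q\<le>j. d (j - q) * impulse_response q v)" using j by simp
    finally show ?thesis by simp
  qed
  then show "impulse_response q v = 0" if "v \<in> carrier_vec m" for q v
    using impulse_response_eq_0[OF d0 d] that by blast
qed

section \<open>Annihilating coefficients\<close>

text \<open>Moving all matrices onto \<xi> represents the free response by a vector independent of
  x, so linear relations among these vectors annihilate it for every x.\<close>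

lemma free_response_transpose:
  assumes "x \<in> carrier_vec n"
  shows "free_response i x = ((sysA \<Sigma> ^\<^sub>m i)\<^sup>T *\<^sub>v ((sysC \<Sigma>)\<^sup>T *\<^sub>v \<xi>)) \<bullet> x"
proof -
  have C: "(sysC \<Sigma>)\<^sup>T *\<^sub>v \<xi> \<in> carrier_vec n" 
    by (metis dims(3) \<xi> mult_mat_vec_carrier transpose_carrier_mat)
  show ?thesis
    unfolding free_response_def transpose_vec_mult_scalar[OF pow_A assms C]
    using transpose_vec_mult_scalar[OF dims(3) powAx_carrier[OF assms] \<xi>] by simp
qed

text \<open>The sum in question is \<xi>^T C d(A) x. Since \<open>mat_sum\<close> describes d(A)
  entrywise, the free response is expanded in coordinates.\<close>

lemma normalized_annihilator_annihilates:
  assumes "normalized_annihilator n (sysA \<Sigma>) d"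
  shows "annihilates d"
  unfolding annihilates_def
proof
  fix x :: "real vec" assume x: "x \<in> carrier_vec n"
  define \<eta> where "\<eta> = (sysC \<Sigma>)\<^sup>T *\<^sub>v \<xi>"
  have \<eta>: "\<eta> \<in> carrier_vec n" 
    unfolding \<eta>_def by (metis dims(3) \<xi> mult_mat_vec_carrier transpose_carrier_mat)
  have ent: "(\<Sum>j\<le>n. d j * (sysA \<Sigma> ^\<^sub>m (n - j)) $$ (r, c)) = 0" if rc: "r < n" "c < n" for r c
  proof -
    have "mat_sum n n (\<lambda>j. d j \<cdot>\<^sub>m (sysA \<Sigma> ^\<^sub>m (n - j))) {0..n} $$ (r, c) = 0"
      using assms rc by (simp add: normalized_annihilator_def)
    moreover have "(d j \<cdot>\<^sub>m (sysA \<Sigma> ^\<^sub>m i)) $$ (r, c) = d j * (sysA \<Sigma> ^\<^sub>m i) $$ (r, c)" for i j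
      by (rule index_smult_mat(1)) (use carrier_matD[OF pow_A[of i]] rc in simp_all)
    ultimately show ?thesis using rc by (simp add: mat_sum_def atLeast0AtMost)
  qed
  have free: "free_response i x = (\<Sum>c<n. \<Sum>r<n. (sysA \<Sigma> ^\<^sub>m i) $$ (r, c) * (\<eta> $ r * x $ c))" for i
    unfolding free_response_transpose[OF x] \<eta>_def[symmetric]
    using carrier_matD[OF pow_A[of i]] \<eta> x
    by (simp add: scalar_prod_def sum_distrib_left atLeast0LessThan mult_ac)
  have "(\<Sum>j\<le>n. d j * free_response (n - j) x) =
    (\<Sum>j\<le>n. \<Sum>c<n. \<Sum>r<n. (d j * (sysA \<Sigma> ^\<^sub>m (n - j)) $$ (r, c)) * (\<eta> $ r * x $ c))"
    by (simp add: free sum_distrib_left mult_ac)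
  \<comment> \<open>With the sum over j innermost, each summand contains an entry of d(A).\<close>
  also have "\<dots> = (\<Sum>c<n. \<Sum>r<n. \<Sum>j\<le>n. (d j * (sysA \<Sigma> ^\<^sub>m (n - j)) $$ (r, c)) * (\<eta> $ r * x $ c))"
    by (subst sum.swap) (intro sum.cong refl sum.swap)
  also have "\<dots> = 0"
    unfolding sum_distrib_right[symmetric] by (intro sum.neutral ballI) (simp add: ent)
  finally show "(\<Sum>j\<le>n. d j * free_response (n - j) x) = 0" .
qed

text \<open>Supplies coefficients for the qualitative claim. A dependence among n+1 vectors of
  dimension n may have a zero top coefficient, whereas d 0 must be nonzero to solve the triangular
  system; the relation is therefore shifted upwards.\<close>

lemma exists_annihilates: "\<exists>d. d 0 \<noteq> 0 \<and> annihilates d"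
proof -
  define \<eta> where "\<eta> = (sysC \<Sigma>)\<^sup>T *\<^sub>v \<xi>"
  define \<kappa> where "\<kappa> i = (sysA \<Sigma> ^\<^sub>m i)\<^sup>T *\<^sub>v \<eta>" for i
  have "\<eta> \<in> carrier_vec n" 
    unfolding \<eta>_def by (metis dims(3) \<xi> mult_mat_vec_carrier transpose_carrier_mat)
  then have \<kappa>: "\<kappa> i \<in> carrier_vec n" for i
    unfolding \<kappa>_def by (metis mult_mat_vec_carrier transpose_carrier_mat pow_A)
  \<comment> \<open>The zero last row makes the n+1 vectors \<kappa> 0, ..., \<kappa> n the columns of a singular square matrix.\<close>
  define K where "K = mat (Suc n) (Suc n) (\<lambda>(r, j). if r < n then \<kappa> j $ r else 0)"
  have K: "K \<in> carrier_mat (Suc n) (Suc n)" by (simp add: K_def)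
  have "det K\<^sup>T = 0"
  proof -
    \<comment> \<open>The last column of the transpose is the zero last row of
      \<open>K\<close>.\<close>
    have "K\<^sup>T *\<^sub>v unit_vec (Suc n) n = 0\<^sub>v (Suc n)"
      by (auto simp: K_def vec_eq_iff)
    moreover have "unit_vec (Suc n) n \<noteq> (0\<^sub>v (Suc n) :: real vec)" by simp
    ultimately show ?thesis
      using det_0_iff_vec_prod_zero_field[of "K\<^sup>T" "Suc n"] K unit_vec_carrier transpose_carrier_mat by blast
  qed
  then have "det K = 0" using det_transpose[OF K] by simp
  then obtain v where v: "v \<in> carrier_vec (Suc n)" "v \<noteq> 0\<^sub>v (Suc n)" "K *\<^sub>v v = 0\<^sub>v (Suc n)"
    using det_0_iff_vec_prod_zero_field[OF K] by blast
  have rel: "(\<Sum>j\<le>n. v $ j * \<kappa> j $ r) = 0" if "r < n" for r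
  proof -
    have "(K *\<^sub>v v) $ r = 0" using v that by simp
    then show ?thesis using v that
      by (simp add: K_def scalar_prod_def mult.commute atLeast0LessThan lessThan_Suc_atMost)
  qed
  have free: "(\<Sum>j\<le>n. v $ j * free_response j x) = 0" if x: "x \<in> carrier_vec n" for x
  proof -
    have "free_response j x = (\<Sum>r<n. \<kappa> j $ r * x $ r)" for j
      unfolding free_response_transpose[OF x] \<kappa>_def[symmetric] \<eta>_def[symmetric]
      using x by (simp add: scalar_prod_def atLeast0LessThan)
    then have "(\<Sum>j\<le>n. v $ j * free_response j x) = (\<Sum>j\<le>n. \<Sum>r<n. v $ j * \<kappa> j $ r * x $ r)"
      by (simp add: sum_distrib_left mult.assoc)
    also have "\<dots> = (\<Sum>r<n. (\<Sum>j\<le>n. v $ j * \<kappa> j $ r) * x $ r)"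
      by (subst sum.swap) (simp add: sum_distrib_right)
    also have "\<dots> = 0" by (simp add: rel)
    finally show ?thesis .
  qed
  \<comment> \<open>A relation with top index r < n is turned into one with leading coefficient d 0 by
    multiplying it with the power n - r of A.\<close>
  define S where "S = {j. j \<le> n \<and> v $ j \<noteq> 0}"
  have "finite S" by (simp add: S_def)
  moreover have "S \<noteq> {}" using v(1,2) by (auto simp: S_def vec_eq_iff less_Suc_eq_le)
  ultimately have "Max S \<in> S" and max: "\<And>j. j \<in> S \<Longrightarrow> j \<le> Max S" by auto
  define r where "r = Max S"
  have r: "r \<le> n" "v $ r \<noteq> 0" using \<open>Max S \<in> S\<close> by (auto simp: S_def r_def)
  have zero: "v $ j = 0" if "r < j" "j \<le> n" for j
  proof (rule ccontr)
    assume "v $ j \<noteq> 0"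
    then have "j \<in> S" using that by (simp add: S_def)
    then show False using max[of j] that by (simp add: r_def)
  qed
  \<comment> \<open>These are the coefficients of z^(n-r) times the sum of the v_i z^i: the power
    z^(n-j) carries v_(r-j), and d 0 = v_r.\<close>
  define d where "d j = (if j \<le> r then v $ (r - j) else 0)" for j
  have "annihilates d"
    unfolding annihilates_def
  proof
    fix x :: "real vec" assume x: "x \<in> carrier_vec n"
    have "(\<Sum>j\<le>n. d j * free_response (n - j) x) = (\<Sum>j\<le>r. v $ (r - j) * free_response (n - j) x)"
      using r(1) by (intro sum.mono_neutral_cong_right) (auto simp: d_def)
    also have "\<dots> = (\<Sum>i\<le>r. v $ i * free_response (n - r + i) x)"
      by (rule sum.reindex_bij_witness[of _ "\<lambda>i. r - i" "\<lambda>i. r - i"]) (use r(1) in auto)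
    also have "\<dots> = (\<Sum>i\<le>n. v $ i * free_response i ((sysA \<Sigma> ^\<^sub>m (n - r)) *\<^sub>v x))"
      using r x zero by (intro sum.mono_neutral_cong_left) (auto simp: free_response_pow add.commute)
    also have "\<dots> = 0" using x by (intro free) simp
    finally show "(\<Sum>j\<le>n. d j * free_response (n - j) x) = 0" .
  qed
  moreover have "d 0 \<noteq> 0" using r by (simp add: d_def)
  ultimately show ?thesis by blast
qed

end


section \<open>Excitation of the output\<close>

text \<open>If \<xi> is orthogonal to every output, the filtered signal vanishes, so all input
  windows are orthogonal to M^T \<xi>. Excitation of the input gives M^T \<xi> = 0, and hence \<xi>
  = 0.\<close>

lemma output_persistently_exciting:
  assumes u: "vec_seq m N u" and pe: "persistently_exciting m N (n + 1) u"
    and \<Sigma>: "\<Sigma> \<in> output_reachable_systems n m p" and x0: "x\<^sub>0 \<in> carrier_vec n"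
  shows "persistently_exciting p N 1 (sys_output \<Sigma> x\<^sub>0 u)"
proof -
  have sys: "\<Sigma> \<in> lti_systems n m p" and r: "output_reachable \<Sigma>"
    using \<Sigma> by (auto simp: output_reachable_systems_def)
  let ?y = "sys_output \<Sigma> x\<^sub>0 u"
  \<comment> \<open>The zero direction gives access to the facts that do not involve \<xi>.\<close>
  interpret z: observed_lti n m p \<Sigma> "0\<^sub>v p" by unfold_locales (use sys in auto)
  have y: "vec_seq p N ?y" by (rule z.output_carrier[OF u x0])
  have "\<xi> = 0\<^sub>v p" if \<xi>: "\<xi> \<in> carrier_vec p" and orth: "\<And>k. k < N \<Longrightarrow> ?y k \<bullet> \<xi> = 0" for \<xi>
  proof -
    interpret observed_lti n m p \<Sigma> \<xi> by unfold_locales (use sys \<xi> in auto)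
    \<comment> \<open>Here d, and with it M, may depend on \<xi>; this is harmless because only
      \<xi> = 0 is to be shown.\<close>
    obtain d where d: "d 0 \<noteq> 0" "annihilates d" using exists_annihilates by blast
    let ?v = "(M_mat n m p \<Sigma> d)\<^sup>T *\<^sub>v \<xi>"
    have v: "?v \<in> carrier_vec (m * Suc n)"
      by (metis M_mat_carrier \<xi> mult_mat_vec_carrier transpose_carrier_mat)
    have "window m u k (k + n) \<bullet> ?v = 0" if k: "k < N - n" for k
    proof -
      have "\<xi> \<bullet> ?y (k + i) = 0" if "i \<le> n" for i
        using orth[of "k + i"] comm_scalar_prod[OF \<xi>, of "?y (k + i)"] y k that
        by (simp add: vec_seq_def)
      then show ?thesis using window_filtered_output[OF u x0 d(2)] k by simp
    qed
    then have "?v = 0\<^sub>v (m * Suc n)"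
      using pe v unfolding Suc_eq_plus1[symmetric] persistently_exciting_iff by blast
    then show ?thesis by (rule M_mat_transpose_eq_0[OF r d])
  qed
  \<comment> \<open>Order 1 is the case n = 0 of the characterization: N windows, each a single
    output.\<close>
  then show ?thesis
    using y unfolding One_nat_def persistently_exciting_iff by (simp add: window_one vec_seq_def)
qed

text \<open>The quadratic form of K_y at \<xi> is that of \<open>K\<close> at M^T \<xi>, divided by
  n+1. It is positive for nonzero \<xi> by full row rank of M, and the bound by the output energy
  follows from the filter identity.\<close>

lemma output_K_persistently_exciting:
  assumes u: "vec_seq m N u" and pd: "pos_def (m * (n + 1)) K"
    and pe: "K_persistently_exciting K m N (n + 1) u"
    and \<Sigma>: "\<Sigma> \<in> output_reachable_systems n m p" and x0: "x\<^sub>0 \<in> carrier_vec n"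
    and d: "normalized_annihilator n (sysA \<Sigma>) d"
  shows "K_persistently_exciting
    ((1 / real (n + 1)) \<cdot>\<^sub>m (M_mat n m p \<Sigma> d * K * (M_mat n m p \<Sigma> d)\<^sup>T))
    p N 1 (sys_output \<Sigma> x\<^sub>0 u)"
proof -
  have sys: "\<Sigma> \<in> lti_systems n m p" and r: "output_reachable \<Sigma>"
    using \<Sigma> by (auto simp: output_reachable_systems_def)
  let ?y = "sys_output \<Sigma> x\<^sub>0 u"
  let ?M = "M_mat n m p \<Sigma> d"
  let ?K = "(1 / real (n + 1)) \<cdot>\<^sub>m (?M * K * ?M\<^sup>T)"
  interpret z: observed_lti n m p \<Sigma> "0\<^sub>v p" by unfold_locales (use sys in auto)
  have y: "vec_seq p N ?y" by (rule z.output_carrier[OF u x0])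
  have M: "?M \<in> carrier_mat p (m * Suc n)" by (rule z.M_mat_carrier)
  have Mt: "?M\<^sup>T \<in> carrier_mat (m * Suc n) p" using M by (rule transpose_carrier_mat[THEN iffD2])
  have K: "K \<in> carrier_mat (m * Suc n) (m * Suc n)" "K\<^sup>T = K"
    and K_pos: "\<And>v. v \<in> carrier_vec (m * Suc n) \<Longrightarrow> v \<noteq> 0\<^sub>v (m * Suc n) \<Longrightarrow> v \<bullet> (K *\<^sub>v v) > 0"
    using pd by (auto simp: pos_def_def)
  have MK: "?M * K \<in> carrier_mat p (m * Suc n)" by (rule mult_carrier_mat[OF M K(1)])
  have MKM: "?M * K * ?M\<^sup>T \<in> carrier_mat p p" by (rule mult_carrier_mat[OF MK Mt])
  have "(?M * K * ?M\<^sup>T)\<^sup>T = ?M * (K * ?M\<^sup>T)"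
    by (simp only: transpose_mult[OF MK Mt] transpose_mult[OF M K(1)] transpose_transpose K(2))
  also have "\<dots> = ?M * K * ?M\<^sup>T" by (rule assoc_mult_mat[OF M K(1) Mt, symmetric])
  finally have "?K\<^sup>T = ?K" by (auto simp: mat_eq_iff)
  note form = congruence_quadratic_form[OF M K(1)]
  have d0: "d 0 \<noteq> 0" and d_norm: "(\<Sum>i\<le>n. (d (n - i))\<^sup>2) = 1"
  proof -
    show "d 0 \<noteq> 0" using d by (simp add: normalized_annihilator_def)
    have "(\<Sum>i\<le>n. (d (n - i))\<^sup>2) = (\<Sum>j\<le>n. (d j)\<^sup>2)"
      by (rule sum.reindex_bij_witness[of _ "\<lambda>j. n - j" "\<lambda>i. n - i"]) auto
    then show "(\<Sum>i\<le>n. (d (n - i))\<^sup>2) = 1"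
      using d by (simp add: normalized_annihilator_def atLeast0AtMost)
  qed
  have pos: "\<xi> \<bullet> (?K *\<^sub>v \<xi>) > 0" if \<xi>: "\<xi> \<in> carrier_vec p" and nz: "\<xi> \<noteq> 0\<^sub>v p" for \<xi>
  proof -
    interpret observed_lti n m p \<Sigma> \<xi> by unfold_locales (use sys \<xi> in auto)
    have "?M\<^sup>T *\<^sub>v \<xi> \<noteq> 0\<^sub>v (m * Suc n)"
      using M_mat_transpose_eq_0[OF r d0 normalized_annihilator_annihilates[OF d]] nz by blast
    then show ?thesis
      unfolding form[OF \<xi>] using K_pos[OF mult_mat_vec_carrier[OF Mt \<xi>]] by simp
  qed
  have le: "\<xi> \<bullet> (?K *\<^sub>v \<xi>) \<le> (\<Sum>k<N. (?y k \<bullet> \<xi>)\<^sup>2)" if \<xi>: "\<xi> \<in> carrier_vec p" for \<xi>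
  proof -
    interpret observed_lti n m p \<Sigma> \<xi> by unfold_locales (use sys \<xi> in auto)
    let ?v = "?M\<^sup>T *\<^sub>v \<xi>"
    have comm: "?y k \<bullet> \<xi> = \<xi> \<bullet> ?y k" if "k < N" for k
      using comm_scalar_prod[OF \<xi>, of "?y k"] y that by (simp add: vec_seq_def)
    have "?v \<bullet> (K *\<^sub>v ?v) \<le> (\<Sum>k<N - n. (window m u k (k + n) \<bullet> ?v)\<^sup>2)"
      using pe mult_mat_vec_carrier[OF Mt \<xi>]
      unfolding Suc_eq_plus1[symmetric] K_persistently_exciting_iff by blast
    also have "\<dots> \<le> (\<Sum>k<N - n. \<Sum>i\<le>n. (\<xi> \<bullet> ?y (k + i))\<^sup>2)"
    proof (rule sum_mono)
      fix k assume "k \<in> {..<N - n}"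
      then have "window m u k (k + n) \<bullet> ?v = (\<Sum>i\<le>n. d (n - i) * (\<xi> \<bullet> ?y (k + i)))"
        using window_filtered_output[OF u x0 normalized_annihilator_annihilates[OF d]] by simp
      \<comment> \<open>Cauchy-Schwarz with the unit coefficient vector;
        \<open>L2_set_mult_ineq\<close> is stated for absolute values, hence the triangle inequality
        first.\<close>
      then have "\<bar>window m u k (k + n) \<bullet> ?v\<bar> \<le> (\<Sum>i\<le>n. \<bar>d (n - i)\<bar> * \<bar>\<xi> \<bullet> ?y (k + i)\<bar>)"
        by (simp only: abs_mult[symmetric] sum_abs)
      also have "\<dots> \<le> L2_set (\<lambda>i. d (n - i)) {..n} * L2_set (\<lambda>i. \<xi> \<bullet> ?y (k + i)) {..n}"
        by (rule L2_set_mult_ineq)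
      also have "\<dots> = sqrt (\<Sum>i\<le>n. (\<xi> \<bullet> ?y (k + i))\<^sup>2)"
        by (simp add: L2_set_def d_norm)
      finally show "(window m u k (k + n) \<bullet> ?v)\<^sup>2 \<le> (\<Sum>i\<le>n. (\<xi> \<bullet> ?y (k + i))\<^sup>2)"
        by (rule sqrt_ge_absD)
    qed
    also have "\<dots> \<le> real (Suc n) * (\<Sum>k<N. (\<xi> \<bullet> ?y k)\<^sup>2)"
      by (rule sum_windows_le) simp
    also have "(\<Sum>k<N. (\<xi> \<bullet> ?y k)\<^sup>2) = (\<Sum>k<N. (?y k \<bullet> \<xi>)\<^sup>2)"
      by (intro sum.cong refl) (simp add: comm)
    finally show ?thesis
      unfolding form[OF \<xi>] by (simp add: field_simps)
  qed
  have "pos_def p ?K" unfolding pos_def_def using MKM \<open>?K\<^sup>T = ?K\<close> pos by auto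
  then show ?thesis
    using y le unfolding One_nat_def K_persistently_exciting_iff by (simp add: window_one vec_seq_def)
qed

theorem mainTheorem2:
  fixes n m p N :: nat and u :: "nat \<Rightarrow> real vec"
  assumes "vec_seq m N u"
  shows
    "(persistently_exciting m N (n + 1) u \<longrightarrow>
       (\<forall>\<Sigma> \<in> output_reachable_systems n m p. \<forall>x\<^sub>0 \<in> carrier_vec n.
          persistently_exciting p N 1 (sys_output \<Sigma> x\<^sub>0 u)))
     \<and>
     (\<forall>K\<^sub>u. pos_def (m * (n + 1)) K\<^sub>u \<and> K_persistently_exciting K\<^sub>u m N (n + 1) u \<longrightarrow>
       (\<forall>\<Sigma> \<in> output_reachable_systems n m p. \<forall>x\<^sub>0 \<in> carrier_vec n.
          \<forall>d. normalized_annihilator n (sysA \<Sigma>) d \<longrightarrow>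
            K_persistently_exciting
              ((1 / real (n + 1)) \<cdot>\<^sub>m (M_mat n m p \<Sigma> d * K\<^sub>u * (M_mat n m p \<Sigma> d)\<^sup>T))
              p N 1 (sys_output \<Sigma> x\<^sub>0 u)))"
  using assms output_persistently_exciting output_K_persistently_exciting by blast

end
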